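(* Let $\Gamma\subset\mathbb{Q}$ be a dense additive subgroup with $1\in\Gamma$. Then $IE(\Gamma)$ and $D(IE(\Gamma))$ are rationally acyclic.
   Context: $IE(\Gamma)$ is the group, under composition, of all bijections $f:[0,1]\to[0,1]$ with $f(0)=0$ for which there exist $0=x_1<x_2<\dots<x_n=1$ in $\Gamma$ and $c_1,\dots,c_{n-1}\in\Gamma$ with $f(t)=t+c_i$ for all $t\in(x_i,x_{i+1}]$. $D(G)$ denotes the derived (commutator) subgroup of a group $G$. A group $G$ is rationally acyclic if $H_n(G,\mathbb{Q})=0$ for all $n\ge1$. *)

theory Defs
  imports
    "HOL-Analysis.Elementary_Topology"
    "HOL-Library.Poly_Mapping"
    "HOL-Algebra.Bij"
    "HOL-Algebra.Coset"
    "HOL-Algebra.Generated_Groups"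
    "HOL-Algebra.Elementary_Groups"
begin

section \<open>Group homology with trivial rational coefficients\<close>

text \<open>
  \<open>H\<^sub>n(G, \<rat>)\<close> is the homology of the inhomogeneous (unnormalised) bar complex: the
  \<open>n\<close>-chains form the rational vector space with basis \<open>G\<^sup>n\<close>, where \<open>[g\<^sub>1|\<dots>|g\<^sub>n]\<close> is encoded as
  a list of length \<open>n\<close> and a chain as a finitely supported function.
\<close>

definition bar_chains :: "('a, 'b) monoid_scheme \<Rightarrow> nat \<Rightarrow> ('a list \<Rightarrow>\<^sub>0 rat) set" where
  "bar_chains G n = {c. \<forall>gs \<in> Poly_Mapping.keys c. length gs = n \<and> set gs \<subseteq> carrier G}"

text \<open>
  The \<open>n + 1\<close> faces of \<open>[g\<^sub>1|\<dots>|g\<^sub>n]\<close> are \<open>[g\<^sub>2|\<dots>|g\<^sub>n]\<close>, then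
  \<open>[g\<^sub>1|\<dots>|g\<^sub>i g\<^sub>i\<^sub>+\<^sub>1|\<dots>|g\<^sub>n]\<close> for \<open>0 < i < n\<close>, and \<open>[g\<^sub>1|\<dots>|g\<^sub>n\<^sub>-\<^sub>1]\<close>; the list indices below start at \<open>0\<close>.
\<close>

definition bar_face :: "('a, 'b) monoid_scheme \<Rightarrow> nat \<Rightarrow> 'a list \<Rightarrow> 'a list" where
  "bar_face G i gs =
     (if i = 0 then tl gs
      else if i = length gs then butlast gs
      else take (i - 1) gs @ [gs ! (i - 1) \<otimes>\<^bsub>G\<^esub> gs ! i] @ drop (i + 1) gs)"

definition bar_boundary ::
    "('a, 'b) monoid_scheme \<Rightarrow> nat \<Rightarrow> ('a list \<Rightarrow>\<^sub>0 rat) \<Rightarrow> ('a list \<Rightarrow>\<^sub>0 rat)" where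
  "bar_boundary G n c =
     (if n = 0 then 0
      else \<Sum>gs \<in> Poly_Mapping.keys c. \<Sum>i\<le>n.
             Poly_Mapping.single (bar_face G i gs) ((-1) ^ i * Poly_Mapping.lookup c gs))"

definition bar_cycle_group :: "('a, 'b) monoid_scheme \<Rightarrow> nat \<Rightarrow> ('a list \<Rightarrow>\<^sub>0 rat) monoid" where
  "bar_cycle_group G n =
     \<lparr>carrier = {c \<in> bar_chains G n. bar_boundary G n c = 0}, mult = (+), one = 0\<rparr>"

definition rational_group_homology ::
    "('a, 'b) monoid_scheme \<Rightarrow> nat \<Rightarrow> ('a list \<Rightarrow>\<^sub>0 rat) set monoid" where
  "rational_group_homology G n =
     bar_cycle_group G n Mod (bar_boundary G (Suc n) ` bar_chains G (Suc n))"

definition rationally_acyclic :: "('a, 'b) monoid_scheme \<Rightarrow> bool" where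
  "rationally_acyclic G \<longleftrightarrow>
     group G \<and> (\<forall>n\<ge>1. trivial_group (rational_group_homology G n))"

definition derived_group :: "('a, 'b) monoid_scheme \<Rightarrow> ('a, 'b) monoid_scheme" where
  "derived_group G = G\<lparr>carrier := derived G (carrier G)\<rparr>"

section \<open>Interval exchange groups\<close>

text \<open>
  Bijections of \<open>[0,1]\<close> are represented, as in \<open>BijGroup\<close>, by functions on \<open>real\<close> that are
  \<open>undefined\<close> outside \<open>[0,1]\<close>.
\<close>

definition interval_exchange :: "real set \<Rightarrow> (real \<Rightarrow> real) \<Rightarrow> bool" where
  "interval_exchange \<Gamma> f \<longleftrightarrow>
     f \<in> Bij {0..1} \<and> f 0 = 0 \<and>
     (\<exists>(n::nat) (x :: nat \<Rightarrow> real) (c :: nat \<Rightarrow> real).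
        2 \<le> n \<and> x 1 = 0 \<and> x n = 1 \<and> strict_mono_on {1..n} x \<and>
        x ` {1..n} \<subseteq> \<Gamma> \<and> c ` {1..<n} \<subseteq> \<Gamma> \<and>
        (\<forall>i\<in>{1..<n}. \<forall>t\<in>{x i<..x (i + 1)}. f t = t + c i))"

definition IE :: "real set \<Rightarrow> (real \<Rightarrow> real) monoid" where
  "IE \<Gamma> = (BijGroup {0..1})\<lparr>carrier := {f. interval_exchange \<Gamma> f}\<rparr>"

end

(*
  A finite set of elements of \<Gamma> has a common denominator N with 1/N \<in> \<Gamma>, so finitely many interval
  exchanges always lie in the finite group of permutations of the cells ((i-1)/N, i/N]. Thus IE(\<Gamma>) and
  all its subgroups are locally finite. The entries of a cycle of positive degree lie in a finite
  subgroup, where averaging contracts the rational bar complex.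
*)
theory Submission
  imports Defs
begin

text \<open>Clearing denominators is not enough: the finite group attached to N has to lie inside
  IE(\<Gamma>), so its breakpoints k/N, and with them 1/N, must belong to \<Gamma>. Bezout's
  identity together with 1 in \<Gamma> provides such N and keeps the property under least common
  multiples. On the homological side the quotient is formed literally by \<open>Mod\<close>, and its
  triviality is obtained from an equality of boundaries and cycles. The contraction gives only one
  inclusion; the other is the vanishing of the squared boundary map, hence the simplicial
  identities.\<close>

section \<open>Rational homology of locally finite groups\<close>

text \<open>\<open>F k r\<close> stands for \<open>r\<close> times the image of the basis element \<open>k\<close>, so the lemmas assume it additive in \<open>r\<close>.\<close>

definition extend_chain :: "('a \<Rightarrow> rat \<Rightarrow> 'b \<Rightarrow>\<^sub>0 rat) \<Rightarrow> ('a \<Rightarrow>\<^sub>0 rat) \<Rightarrow> ('b \<Rightarrow>\<^sub>0 rat)" where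
  "extend_chain F c = (\<Sum>k\<in>Poly_Mapping.keys c. F k (Poly_Mapping.lookup c k))"

lemma extend_chain_superset:
  assumes "\<And>k. F k 0 = 0" and "finite A" and "Poly_Mapping.keys c \<subseteq> A"
  shows "extend_chain F c = (\<Sum>k\<in>A. F k (Poly_Mapping.lookup c k))"
  unfolding extend_chain_def
  by (rule sum.mono_neutral_left) (use assms in \<open>auto simp: in_keys_iff\<close>)

lemma extend_chain_single:
  assumes "\<And>k. F k 0 = 0"
  shows "extend_chain F (Poly_Mapping.single k r) = F k r"
  by (subst extend_chain_superset[where A = "{k}"]) (auto simp: assms)

lemma extend_chain_add:
  assumes "\<And>k a b. F k (a + b) = F k a + F k b"
  shows "extend_chain F (c + d) = extend_chain F c + extend_chain F d"
proof -
  have z: "F k 0 = 0" for k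
    using assms[of k 0 0] by simp
  let ?A = "Poly_Mapping.keys c \<union> Poly_Mapping.keys d"
  \<comment> \<open>Coefficients may cancel in \<open>c + d\<close>, so its keys can be fewer than
    \<open>?A\<close>; all three sums are taken over the same index set before they are
    compared.\<close>
  have "extend_chain F e = (\<Sum>k\<in>?A. F k (Poly_Mapping.lookup e k))"
    if "Poly_Mapping.keys e \<subseteq> ?A" for e
    using that by (intro extend_chain_superset z) auto
  then show ?thesis
    by (simp add: keys_add assms lookup_add sum.distrib)
qed

lemma extend_chain_sum:
  assumes "\<And>k a b. F k (a + b) = F k a + F k b"
  shows "extend_chain F (\<Sum>i\<in>I. c i) = (\<Sum>i\<in>I. extend_chain F (c i))"
  by (induction I rule: infinite_finite_induct)
    (simp_all add: extend_chain_add[of F, OF assms] extend_chain_def[of F 0])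

lemma sum_single_lookup:
  "(\<Sum>k\<in>Poly_Mapping.keys c. Poly_Mapping.single k (Poly_Mapping.lookup c k)) = (c :: 'a \<Rightarrow>\<^sub>0 rat)"
  by (rule poly_mapping_eqI) (simp add: lookup_sum lookup_single when_def in_keys_iff)

text \<open>Reduces an identity between composites of linear maps to single basis elements; the
  squared boundary and the homotopy formula are both treated this way.\<close>

lemma extend_chain_compose:
  assumes "\<And>k a b. F k (a + b) = F k a + F k b" and "\<And>k a b. E k (a + b) = E k a + E k b"
  shows "extend_chain F (extend_chain E c) = extend_chain (\<lambda>k r. extend_chain F (E k r)) c"
  by (simp only: extend_chain_def[of E] extend_chain_sum[of F, OF assms(1)])
    (simp add: extend_chain_def)

definition boundary_term ::
    "('a, 'b) monoid_scheme \<Rightarrow> nat \<Rightarrow> 'a list \<Rightarrow> rat \<Rightarrow> 'a list \<Rightarrow>\<^sub>0 rat" where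
  "boundary_term G n gs r = (\<Sum>i\<le>n. Poly_Mapping.single (bar_face G i gs) ((-1) ^ i * r))"

lemma boundary_term_add: "boundary_term G n gs (a + b) = boundary_term G n gs a + boundary_term G n gs b"
  by (simp add: boundary_term_def single_add ring_distribs sum.distrib)

lemma bar_boundary_eq: "n > 0 \<Longrightarrow> bar_boundary G n c = extend_chain (boundary_term G n) c"
  by (simp add: bar_boundary_def extend_chain_def boundary_term_def)

lemma bar_boundary_add: "bar_boundary G n (c + d) = bar_boundary G n c + bar_boundary G n d"
  by (cases "n = 0") (simp add: bar_boundary_def, simp add: bar_boundary_eq extend_chain_add boundary_term_add)

lemma bar_boundary_uminus: "bar_boundary G n (- c) = - bar_boundary G n c"
proof -
  have "bar_boundary G n 0 = 0"
    by (simp add: bar_boundary_def)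
  then have "bar_boundary G n (- c) + bar_boundary G n c = 0"
    by (simp flip: bar_boundary_add)
  then show ?thesis
    by (simp add: eq_neg_iff_add_eq_0)
qed

section \<open>Simplicial identities and the square of the boundary map\<close>

lemma length_bar_face:
  "i \<le> length gs \<Longrightarrow> gs \<noteq> [] \<Longrightarrow> length (bar_face G i gs) = length gs - 1"
  by (auto simp: bar_face_def)

text \<open>One formula covers the outer and the inner faces, which turns the simplicial identity
  into a comparison of indices.\<close>

lemma nth_bar_face:
  assumes "i \<le> length gs" and "k < length gs - 1"
  shows "bar_face G i gs ! k =
    (if k + 1 < i then gs ! k
     else if k + 1 = i then gs ! k \<otimes>\<^bsub>G\<^esub> gs ! (k + 1)
     else gs ! (k + 1))"
  using assms by (auto simp: bar_face_def nth_tl nth_butlast nth_append min_def)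

context group
begin

lemma set_bar_face:
  assumes "set gs \<subseteq> carrier G" and "i \<le> length gs" and "gs \<noteq> []"
  shows "set (bar_face G i gs) \<subseteq> carrier G"
proof -
  have "gs ! k \<in> carrier G" if "k < length gs" for k
    using assms(1) that by (meson nth_mem subsetD)
  then show ?thesis
    using assms(2,3) by (auto simp: in_set_conv_nth length_bar_face nth_bar_face)
qed

text \<open>The simplicial identity. The two sides merge the same neighbours in a different order,
  and only for \<open>j = i + 1\<close> do both merge the same three entries, where associativity
  enters. With at least two entries the intermediate lists are nonempty.\<close>

lemma bar_face_bar_face:
  assumes "set gs \<subseteq> carrier G" and "i < j" and "j \<le> length gs" and "length gs \<ge> 2"
  shows "bar_face G i (bar_face G j gs) = bar_face G (j - 1) (bar_face G i gs)"
proof (rule nth_equalityI)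
  have ne: "gs \<noteq> []" "bar_face G i gs \<noteq> []" "bar_face G j gs \<noteq> []"
    using assms length_bar_face[of i gs G] length_bar_face[of j gs G] by fastforce+
  show "length (bar_face G i (bar_face G j gs)) = length (bar_face G (j - 1) (bar_face G i gs))"
    using assms ne by (simp add: length_bar_face)
  fix k
  assume "k < length (bar_face G i (bar_face G j gs))"
  then have k: "k < length gs - 2"
    using assms ne by (simp add: length_bar_face)
  have mem: "gs ! k \<in> carrier G" "gs ! Suc k \<in> carrier G" "gs ! Suc (Suc k) \<in> carrier G"
    using k by (simp_all add: subsetD[OF assms(1)])
  have l: "length (bar_face G i gs) = length gs - 1" "length (bar_face G j gs) = length gs - 1"
    using assms ne by (simp_all add: length_bar_face)
  show "bar_face G i (bar_face G j gs) ! k = bar_face G (j - 1) (bar_face G i gs) ! k"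
    using assms k mem by (auto simp: nth_bar_face l m_assoc)
qed

lemma bar_boundary_chain:
  assumes "c \<in> bar_chains G (Suc n)"
  shows "bar_boundary G (Suc n) c \<in> bar_chains G n"
proof -
  have face: "length hs = n \<and> set hs \<subseteq> carrier G"
    if "hs = bar_face G i gs" "gs \<in> Poly_Mapping.keys c" "i \<le> Suc n" for hs gs i
  proof -
    have "length gs = Suc n" "set gs \<subseteq> carrier G"
      using assms that by (auto simp: bar_chains_def)
    then show ?thesis
      using that set_bar_face[of gs i] length_bar_face[of i gs G] by fastforce
  qed
  have keys: "Poly_Mapping.keys (bar_boundary G (Suc n) c)
      \<subseteq> (\<Union>gs\<in>Poly_Mapping.keys c. (\<lambda>i. bar_face G i gs) ` {..Suc n})"
  proof -
    have *: "Poly_Mapping.keys (boundary_term G (Suc n) gs r) \<subseteq> (\<lambda>i. bar_face G i gs) ` {..Suc n}"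
      for gs r
      unfolding boundary_term_def by (rule order_trans[OF keys_sum]) (auto split: if_splits)
    have "Poly_Mapping.keys (bar_boundary G (Suc n) c)
        \<subseteq> (\<Union>gs\<in>Poly_Mapping.keys c.
              Poly_Mapping.keys (boundary_term G (Suc n) gs (Poly_Mapping.lookup c gs)))"
      by (simp add: bar_boundary_eq extend_chain_def keys_sum)
    also have "\<dots> \<subseteq> (\<Union>gs\<in>Poly_Mapping.keys c. (\<lambda>i. bar_face G i gs) ` {..Suc n})"
      by (intro UN_mono order_refl *)
    finally show ?thesis .
  qed
  show ?thesis
    unfolding bar_chains_def
  proof (intro CollectI ballI)
    fix hs
    assume "hs \<in> Poly_Mapping.keys (bar_boundary G (Suc n) c)"
    then obtain gs i where "gs \<in> Poly_Mapping.keys c" "i \<le> Suc n" "hs = bar_face G i gs"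
      using subsetD[OF keys] by blast
    then show "length hs = n \<and> set hs \<subseteq> carrier G"
      by (intro face)
  qed
qed

lemma bar_boundary_boundary_term:
  assumes "set gs \<subseteq> carrier G" and "length gs = Suc (Suc n)"
  shows "bar_boundary G (Suc n) (boundary_term G (Suc (Suc n)) gs r) = 0"
proof -
  define s where "s i j = Poly_Mapping.single (bar_face G i (bar_face G j gs)) ((-1) ^ (i + j) * r)"
    for i j
  let ?I = "{..Suc n} \<times> {..Suc (Suc n)}"
  have z: "boundary_term G n gs 0 = 0" for n gs
    by (simp add: boundary_term_def)
  have "bar_boundary G (Suc n) (boundary_term G (Suc (Suc n)) gs r)
      = (\<Sum>j\<le>Suc (Suc n). boundary_term G (Suc n) (bar_face G j gs) ((-1) ^ j * r))"
    by (simp del: sum.atMost_Suc add: bar_boundary_eq boundary_term_def[of _ "Suc (Suc n)"]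
        extend_chain_sum extend_chain_single boundary_term_add z)
  also have "\<dots> = (\<Sum>j\<le>Suc (Suc n). \<Sum>i\<le>Suc n. s i j)"
    by (simp del: sum.atMost_Suc add: boundary_term_def s_def power_add mult.assoc)
  also have "\<dots> = (\<Sum>(i, j)\<in>?I. s i j)"
    by (subst sum.swap) (rule sum.cartesian_product)
  also have "\<dots> = (\<Sum>(i, j)\<in>{p \<in> ?I. fst p < snd p}. s i j) + (\<Sum>(i, j)\<in>{p \<in> ?I. \<not> fst p < snd p}. s i j)"
    by (subst sum.union_disjoint[symmetric]) (auto intro!: sum.cong)
  \<comment> \<open>The pair (i, j) with i < j is matched with (j - 1, i): the simplicial identity
    makes the two faces equal, while i + j drops by one and flips the sign.\<close>
  also have "(\<Sum>(i, j)\<in>{p \<in> ?I. fst p < snd p}. s i j) = (\<Sum>(i, j)\<in>{p \<in> ?I. \<not> fst p < snd p}. - s i j)"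
  proof (rule sum.reindex_bij_witness[where j = "\<lambda>(i, j). (j - 1, i)" and i = "\<lambda>(i, j). (j, Suc i)"])
    fix p
    assume "p \<in> {p \<in> ?I. fst p < snd p}"
    then obtain i j where p: "p = (i, Suc j)" "i \<le> j" "j \<le> Suc n"
      by (cases p; cases "snd p") auto
    have "bar_face G i (bar_face G (Suc j) gs) = bar_face G j (bar_face G i gs)"
      using bar_face_bar_face[of gs i "Suc j"] p assms by simp
    then show "(case case p of (i, j) \<Rightarrow> (j - 1, i) of (i, j) \<Rightarrow> - s i j) = (case p of (i, j) \<Rightarrow> s i j)"
      using p by (simp add: s_def add.commute flip: single_uminus)
  qed auto
  finally show ?thesis
    by (simp add: case_prod_unfold sum_negf)
qed

lemma bar_boundary_bar_boundary:
  assumes "c \<in> bar_chains G (Suc n)"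
  shows "bar_boundary G n (bar_boundary G (Suc n) c) = 0"
proof (cases n)
  case 0
  then show ?thesis by (simp add: bar_boundary_def)
next
  case (Suc m)
  have "bar_boundary G n (bar_boundary G (Suc n) c)
      = extend_chain (\<lambda>gs r. bar_boundary G n (boundary_term G (Suc n) gs r)) c"
    using Suc by (simp add: bar_boundary_eq extend_chain_compose boundary_term_add)
  also have "\<dots> = 0"
    using assms Suc bar_boundary_boundary_term[of _ m]
    by (auto simp: extend_chain_def bar_chains_def intro!: sum.neutral)
  finally show ?thesis .
qed

end

section \<open>Contraction over a finite subgroup\<close>

text \<open>
  Prepending an element \<open>x\<close> contracts the bar complex up to the inner face \<open>[x g\<^sub>1|g\<^sub>2|\<dots>]\<close>, which
  depends on \<open>x\<close>; averaging over a finite group makes that face independent of \<open>g\<^sub>1\<close>.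
\<close>

definition average_cone :: "'a set \<Rightarrow> 'a list \<Rightarrow> rat \<Rightarrow> 'a list \<Rightarrow>\<^sub>0 rat" where
  "average_cone H gs r = (\<Sum>x\<in>H. Poly_Mapping.single (x # gs) (r / of_nat (card H)))"

lemma average_cone_add: "average_cone H gs (a + b) = average_cone H gs a + average_cone H gs b"
  by (simp add: average_cone_def single_add add_divide_distrib sum.distrib)

lemma sum_single_const:
  "(\<Sum>x\<in>A. Poly_Mapping.single k (r :: rat)) = Poly_Mapping.single k (of_nat (card A) * r)"
  by (rule poly_mapping_eqI) (simp add: lookup_sum lookup_single when_def)

context group
begin

text \<open>For \<open>i > 0\<close> the face leaves \<open>x\<close> alone and the summands agree
  one by one. For \<open>i = 0\<close> the new head is \<open>x\<close> times the first entry g of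
  \<open>gs\<close>, and right translation by g permutes \<open>H\<close>, so only the sums
  agree.\<close>

lemma sum_bar_face_Cons:
  assumes H: "subgroup H G" and gs: "set gs \<subseteq> H" "gs \<noteq> []" and i: "i \<le> length gs"
  shows "(\<Sum>x\<in>H. Poly_Mapping.single (bar_face G (Suc i) (x # gs)) (r :: rat))
    = (\<Sum>x\<in>H. Poly_Mapping.single (x # bar_face G i gs) r)"
proof (cases "i = 0")
  case True
  obtain g hs where g: "gs = g # hs" "g \<in> H"
    using gs by (cases gs) auto
  have c: "x \<in> H \<Longrightarrow> x \<in> carrier G" for x
    using subgroup.mem_carrier[OF H] .
  show ?thesis
    by (rule sum.reindex_bij_witness[where j = "\<lambda>x. x \<otimes> g" and i = "\<lambda>x. x \<otimes> inv g"])
      (use True g c H in \<open>auto simp: bar_face_def m_assoc subgroup.m_closed subgroup.m_inv_closed\<close>)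
next
  case False
  then show ?thesis
    using gs i by (auto simp: bar_face_def Cons_nth_drop_Suc nth_Cons' take_Cons' intro!: sum.cong)
qed

text \<open>Face 0 of \<open>x # gs\<close> removes \<open>x\<close> and yields the identity term.
  After summation over \<open>H\<close>, each later face is a cone over a face of \<open>gs\<close>
  with index lowered by one, which accounts for the minus sign.\<close>

lemma average_cone_homotopy:
  assumes H: "subgroup H G" "finite H" and gs: "set gs \<subseteq> H" "length gs = n" "n > 0"
  shows "extend_chain (boundary_term G (Suc n)) (average_cone H gs r)
    = Poly_Mapping.single gs r - extend_chain (average_cone H) (boundary_term G n gs r)"
proof -
  let ?q = "r / of_nat (card H)"
  have card: "card H \<noteq> 0"
    using H subgroup.one_closed[OF H(1)] by auto
  have z: "boundary_term G n gs 0 = 0" "average_cone H gs 0 = 0" for n gs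
    by (simp_all add: boundary_term_def average_cone_def)
  have "extend_chain (boundary_term G (Suc n)) (average_cone H gs r)
      = (\<Sum>x\<in>H. boundary_term G (Suc n) (x # gs) ?q)"
    by (simp add: average_cone_def extend_chain_sum extend_chain_single boundary_term_add z)
  also have "\<dots> = (\<Sum>x\<in>H. Poly_Mapping.single gs ?q)
      + (\<Sum>x\<in>H. \<Sum>i\<le>n. Poly_Mapping.single (bar_face G (Suc i) (x # gs)) ((-1) ^ Suc i * ?q))"
    by (simp del: sum.atMost_Suc add: boundary_term_def sum.atMost_Suc_shift sum.distrib)
      (simp add: bar_face_def)
  \<comment> \<open>Here \<open>card H\<close> copies of r / \<open>card H\<close> add up to r; this
    is what the division in \<open>average_cone\<close> is for.\<close>
  also have "(\<Sum>x\<in>H. Poly_Mapping.single gs ?q) = Poly_Mapping.single gs r"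
    using card by (simp add: sum_single_const)
  also have "(\<Sum>x\<in>H. \<Sum>i\<le>n. Poly_Mapping.single (bar_face G (Suc i) (x # gs)) ((-1) ^ Suc i * ?q))
      = (\<Sum>i\<le>n. \<Sum>x\<in>H. Poly_Mapping.single (x # bar_face G i gs) ((-1) ^ Suc i * ?q))"
    by (subst sum.swap, rule sum.cong[OF refl], rule sum_bar_face_Cons) (use gs H in auto)
  also have "\<dots> = - extend_chain (average_cone H) (boundary_term G n gs r)"
    by (simp add: boundary_term_def extend_chain_sum extend_chain_single average_cone_add z)
      (simp add: average_cone_def single_uminus sum_negf)
  finally show ?thesis by simp
qed

text \<open>The averaged cone over \<open>c\<close> is the witness: the homotopy formula gives its
  boundary as \<open>c\<close> minus the cone over the boundary of \<open>c\<close>, which is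
  zero.\<close>

lemma bar_cycle_is_boundary:
  assumes H: "subgroup H G" "finite H" and n: "n > 0"
    and keys: "\<And>gs. gs \<in> Poly_Mapping.keys c \<Longrightarrow> set gs \<subseteq> H \<and> length gs = n"
    and cycle: "bar_boundary G n c = 0"
  shows "c \<in> bar_boundary G (Suc n) ` bar_chains G (Suc n)"
proof
  have "bar_boundary G (Suc n) (extend_chain (average_cone H) c)
      = extend_chain (\<lambda>gs r. extend_chain (boundary_term G (Suc n)) (average_cone H gs r)) c"
    by (simp add: bar_boundary_eq extend_chain_compose average_cone_add boundary_term_add)
  also have "\<dots> = extend_chain (\<lambda>gs r. Poly_Mapping.single gs r
      - extend_chain (average_cone H) (boundary_term G n gs r)) c"
    unfolding extend_chain_def[of _ c]
    using keys n by (intro sum.cong refl average_cone_homotopy H) auto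
  also have "\<dots> = c - extend_chain (\<lambda>gs r. extend_chain (average_cone H) (boundary_term G n gs r)) c"
    by (simp add: extend_chain_def[of _ c] sum_subtractf sum_single_lookup)
  also have "\<dots> = c - extend_chain (average_cone H) (bar_boundary G n c)"
    using n by (simp add: bar_boundary_eq extend_chain_compose average_cone_add boundary_term_add)
  also have "\<dots> = c"
    by (simp add: cycle extend_chain_def)
  finally show "c = bar_boundary G (Suc n) (extend_chain (average_cone H) c)" ..
  have "Poly_Mapping.keys (average_cone H gs r) \<subseteq> (\<lambda>x. x # gs) ` H" for gs r
    unfolding average_cone_def by (rule order_trans[OF keys_sum]) (auto split: if_splits)
  then have "Poly_Mapping.keys (extend_chain (average_cone H) c)
      \<subseteq> {x # gs | x gs. x \<in> H \<and> gs \<in> Poly_Mapping.keys c}"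
    unfolding extend_chain_def by (intro order_trans[OF keys_sum]) blast
  then show "extend_chain (average_cone H) c \<in> bar_chains G (Suc n)"
    using keys subgroup.subset[OF H(1)] by (fastforce simp: bar_chains_def)
qed

end

section \<open>Locally finite groups\<close>

lemma comm_group_bar_cycle_group: "comm_group (bar_cycle_group G n)"
proof (rule comm_groupI)
  fix c d
  assume "c \<in> carrier (bar_cycle_group G n)" "d \<in> carrier (bar_cycle_group G n)"
  then show "c \<otimes>\<^bsub>bar_cycle_group G n\<^esub> d \<in> carrier (bar_cycle_group G n)"
    using keys_add[of c d] by (auto simp: bar_cycle_group_def bar_chains_def bar_boundary_add)
next
  fix c
  assume "c \<in> carrier (bar_cycle_group G n)"
  then have "- c \<in> carrier (bar_cycle_group G n)"
    by (simp add: bar_cycle_group_def bar_chains_def bar_boundary_uminus in_keys_iff)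
  then show "\<exists>d\<in>carrier (bar_cycle_group G n). d \<otimes>\<^bsub>bar_cycle_group G n\<^esub> c = \<one>\<^bsub>bar_cycle_group G n\<^esub>"
    by (rule bexI[rotated]) (simp add: bar_cycle_group_def)
qed (simp_all add: bar_cycle_group_def bar_chains_def bar_boundary_def ac_simps)

text \<open>Phrased with an enclosing finite subgroup, not with the generated one: the grid groups
  can be exhibited directly, without any argument about generation.\<close>

definition locally_finite_group :: "('a, 'b) monoid_scheme \<Rightarrow> bool" where
  "locally_finite_group G \<longleftrightarrow> group G \<and>
     (\<forall>S. finite S \<and> S \<subseteq> carrier G \<longrightarrow> (\<exists>H. subgroup H G \<and> finite H \<and> S \<subseteq> H))"

theorem locally_finite_group_rationally_acyclic:
  assumes "locally_finite_group G"
  shows "rationally_acyclic G"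
  unfolding rationally_acyclic_def
proof (intro conjI allI impI)
  show G: "group G"
    using assms by (simp add: locally_finite_group_def)
  fix n :: nat
  assume n: "n \<ge> 1"
  interpret group G by (rule G)
  interpret Z: comm_group "bar_cycle_group G n" by (rule comm_group_bar_cycle_group)
  have "bar_boundary G (Suc n) ` bar_chains G (Suc n) = carrier (bar_cycle_group G n)"
  proof
    show "bar_boundary G (Suc n) ` bar_chains G (Suc n) \<subseteq> carrier (bar_cycle_group G n)"
      by (auto simp: bar_cycle_group_def bar_boundary_chain bar_boundary_bar_boundary)
    show "carrier (bar_cycle_group G n) \<subseteq> bar_boundary G (Suc n) ` bar_chains G (Suc n)"
    proof
      fix c
      assume "c \<in> carrier (bar_cycle_group G n)"
      then have c: "\<forall>gs\<in>Poly_Mapping.keys c. length gs = n \<and> set gs \<subseteq> carrier G" "bar_boundary G n c = 0"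
        by (auto simp: bar_cycle_group_def bar_chains_def)
      then obtain H where "subgroup H G" "finite H" "(\<Union>gs\<in>Poly_Mapping.keys c. set gs) \<subseteq> H"
        using assms unfolding locally_finite_group_def
        by (elim conjE allE[where x = "\<Union>gs\<in>Poly_Mapping.keys c. set gs"]) auto
      then show "c \<in> bar_boundary G (Suc n) ` bar_chains G (Suc n)"
        using c n by (intro bar_cycle_is_boundary) auto
    qed
  qed
  moreover have "trivial_group (bar_cycle_group G n Mod carrier (bar_cycle_group G n))"
  proof -
    have "group (bar_cycle_group G n Mod carrier (bar_cycle_group G n))"
      by (intro normal.factorgroup_is_group Z.normal_self)
    moreover have "rcosets\<^bsub>bar_cycle_group G n\<^esub> carrier (bar_cycle_group G n) = {carrier (bar_cycle_group G n)}"
      by (auto simp: RCOSETS_def Z.coset_join2 Z.subgroup_self)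
    ultimately show ?thesis
      by (simp add: trivial_group_def FactGroup_def)
  qed
  ultimately show "trivial_group (rational_group_homology G n)"
    by (simp add: rational_group_homology_def)
qed

lemma locally_finite_group_subgroup:
  assumes "locally_finite_group G" and K: "subgroup K G"
  shows "locally_finite_group (G\<lparr>carrier := K\<rparr>)"
proof -
  interpret group G
    using assms by (simp add: locally_finite_group_def)
  have "\<exists>H. subgroup H (G\<lparr>carrier := K\<rparr>) \<and> finite H \<and> S \<subseteq> H" if S: "finite S" "S \<subseteq> K" for S
  proof -
    obtain H where H: "subgroup H G" "finite H" "S \<subseteq> H"
      using assms(1) S subgroup.subset[OF K] unfolding locally_finite_group_def by blast
    \<comment> \<open>\<open>H\<close> may stick out of \<open>K\<close>; the intersection is still
      finite and contains \<open>S\<close>.\<close>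
    have "subgroup (H \<inter> K) (G\<lparr>carrier := K\<rparr>)"
      by (intro subgroup_incl subgroups_Inter_pair H K) auto
    then show ?thesis
      using H S by blast
  qed
  then show ?thesis
    unfolding locally_finite_group_def using subgroup_imp_group[OF K] by simp
qed

section \<open>Interval exchanges on a grid\<close>

text \<open>The number \<open>\<lceil>N t\<rceil>\<close> is the index of the cell containing \<open>t\<close>.\<close>

definition grid_exchanges :: "nat \<Rightarrow> (real \<Rightarrow> real) set" where
  "grid_exchanges N = {f \<in> Bij {0..1}. f 0 = 0 \<and>
     (\<forall>t\<in>{0<..1}. real N * (f t - t) \<in> \<int>) \<and>
     (\<forall>s\<in>{0<..1}. \<forall>t\<in>{0<..1}. \<lceil>real N * s\<rceil> = \<lceil>real N * t\<rceil> \<longrightarrow> f s - s = f t - t)}"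

lemma grid_exchange_Bij: "f \<in> grid_exchanges N \<Longrightarrow> f \<in> Bij {0..1}"
  by (simp add: grid_exchanges_def)

lemma grid_exchange_Ints:
  "f \<in> grid_exchanges N \<Longrightarrow> t \<in> {0<..1} \<Longrightarrow> real N * (f t - t) \<in> \<int>"
  unfolding grid_exchanges_def by blast

lemma grid_exchange_cell:
  "f \<in> grid_exchanges N \<Longrightarrow> s \<in> {0<..1} \<Longrightarrow> t \<in> {0<..1} \<Longrightarrow>
    \<lceil>real N * s\<rceil> = \<lceil>real N * t\<rceil> \<Longrightarrow> f s - s = f t - t"
  unfolding grid_exchanges_def by blast

lemma grid_exchange_0: "f \<in> grid_exchanges N \<Longrightarrow> f 0 = 0"
  unfolding grid_exchanges_def by blast

lemma grid_exchange_inj: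
  "f \<in> grid_exchanges N \<Longrightarrow> s \<in> {0..1} \<Longrightarrow> t \<in> {0..1} \<Longrightarrow> f s = f t \<Longrightarrow> s = t"
  by (auto dest!: grid_exchange_Bij simp: Bij_def bij_betw_def inj_on_def)

text \<open>Injectivity and f(0) = 0 keep 0 out of the image of (0,1], the union of the
  cells.\<close>

lemma grid_exchange_range:
  assumes "f \<in> grid_exchanges N" and "t \<in> {0<..1}"
  shows "f t \<in> {0<..1}"
proof -
  have "f t \<in> {0..1}"
    using Bij_imp_funcset[OF grid_exchange_Bij[OF assms(1)]] assms(2) by auto
  moreover have "f t \<noteq> 0"
    using grid_exchange_inj[OF assms(1), of t 0] grid_exchange_0[OF assms(1)] assms(2) by auto
  ultimately show ?thesis by auto
qed

text \<open>Cells are open on the left and closed on the right, so the right end point belongs to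
  its cell and can represent it.\<close>

lemma ceiling_grid_point:
  assumes "N > 0" and "t \<in> {0<..1}"
  shows "\<lceil>real N * t\<rceil> / real N \<in> {0<..1}" and "\<lceil>real N * (\<lceil>real N * t\<rceil> / real N)\<rceil> = \<lceil>real N * t\<rceil>"
proof -
  have "0 < \<lceil>real N * t\<rceil>"
    using assms by simp
  moreover have "\<lceil>real N * t\<rceil> \<le> int N"
    using assms by (simp add: ceiling_le_iff)
  ultimately show "\<lceil>real N * t\<rceil> / real N \<in> {0<..1}"
    using assms(1) by (simp add: divide_le_eq flip: of_int_le_iff[where 'a = real])
  show "\<lceil>real N * (\<lceil>real N * t\<rceil> / real N)\<rceil> = \<lceil>real N * t\<rceil>"
    using assms(1) by simp
qed

lemma grid_exchange_at_grid_point: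
  assumes "N > 0" and "f \<in> grid_exchanges N" and "t \<in> {0<..1}"
  shows "f t = t + f (\<lceil>real N * t\<rceil> / real N) - \<lceil>real N * t\<rceil> / real N"
proof -
  have "f t - t = f (\<lceil>real N * t\<rceil> / real N) - \<lceil>real N * t\<rceil> / real N"
    by (rule grid_exchange_cell[OF assms(2,3) ceiling_grid_point(1)[OF assms(1,3)]])
      (rule ceiling_grid_point(2)[OF assms(1,3), symmetric])
  then show ?thesis by simp
qed

text \<open>Integer shifts pass through the ceiling. Hence points of one cell are sent into one
  cell, which closure under composition and inverse relies on.\<close>

lemma grid_exchange_ceiling:
  assumes "f \<in> grid_exchanges N" and "t \<in> {0<..1}"
  shows "real_of_int \<lceil>real N * f t\<rceil> = real N * (f t - t) + \<lceil>real N * t\<rceil>"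
proof -
  obtain k where k: "real N * (f t - t) = of_int k"
    using Ints_cases[OF grid_exchange_Ints[OF assms]] .
  have "\<lceil>real N * f t\<rceil> = \<lceil>real N * t + of_int k\<rceil>"
    using k by (simp add: algebra_simps)
  then show ?thesis
    using k by simp
qed

lemma finite_grid_exchanges:
  assumes "N > 0"
  shows "finite (grid_exchanges N)"
proof (rule inj_on_finite)
  \<comment> \<open>An exchange is encoded by its values at the right end points i/N; the shifts are
    multiples of 1/N, so these values are too.\<close>
  let ?values = "(\<lambda>k. of_int k / real N) ` {0..int N}"
  let ?F = "\<lambda>f. \<lambda>i\<in>{1..int N}. f (of_int i / real N) :: real"
  show "finite ({1..int N} \<rightarrow>\<^sub>E ?values)"
    by (intro finite_PiE) auto
  show "?F ` grid_exchanges N \<subseteq> {1..int N} \<rightarrow>\<^sub>E ?values"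
  proof (intro image_subsetI restrict_PiE_iff[THEN iffD2] ballI)
    fix f i
    assume f: "f \<in> grid_exchanges N" and i: "i \<in> {1..int N}"
    have t: "of_int i / real N \<in> {0<..1}"
      using i by auto
    obtain k where "real N * (f (of_int i / real N) - of_int i / real N) = of_int k"
      using Ints_cases[OF grid_exchange_Ints[OF f t]] .
    then have "f (of_int i / real N) - of_int i / real N = of_int k / real N"
      using assms by (simp add: eq_divide_eq mult.commute)
    then have k: "f (of_int i / real N) = of_int (k + i) / real N"
      by (simp add: add_divide_distrib)
    moreover have "k + i \<in> {0..int N}"
      using grid_exchange_range[OF f t] assms
      by (auto simp: k zero_less_divide_iff divide_le_eq simp del: of_int_add)
    ultimately show "f (of_int i / real N) \<in> ?values"
      by blast
  qed
  show "inj_on ?F (grid_exchanges N)"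
  proof (rule inj_onI, rule extensionalityI)
    fix f g
    assume f: "f \<in> grid_exchanges N" and g: "g \<in> grid_exchanges N" and eq: "?F f = ?F g"
    show "f \<in> extensional {0..1}" "g \<in> extensional {0..1}"
      by (intro Bij_imp_extensional grid_exchange_Bij[OF f] grid_exchange_Bij[OF g])+
    fix t :: real
    assume t: "t \<in> {0..1}"
    show "f t = g t"
    proof (cases "t = 0")
      case True
      then show ?thesis by (simp add: grid_exchange_0[OF f] grid_exchange_0[OF g])
    next
      case False
      then have t: "t \<in> {0<..1}" using t by auto
      have "\<lceil>real N * t\<rceil> \<in> {1..int N}"
        using ceiling_grid_point(1)[OF assms t] assms by (auto simp: zero_less_divide_iff divide_le_eq)
      from fun_cong[OF eq, of "\<lceil>real N * t\<rceil>"] this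
      show ?thesis
        using grid_exchange_at_grid_point[OF assms f t] grid_exchange_at_grid_point[OF assms g t] by simp
    qed
  qed
qed

lemma grid_exchanges_mono:
  assumes "N dvd M" and "M > 0"
  shows "grid_exchanges N \<subseteq> grid_exchanges M"
proof -
  obtain k where k: "M = k * N"
    using assms by (metis dvd_div_mult_self)
  have "real k * x \<in> \<int>" if "x \<in> \<int>" for x
    using that by simp
  then have "real M * x \<in> \<int>" if "real N * x \<in> \<int>" for x
    using that by (simp add: k mult.assoc)
  \<comment> \<open>The finer index determines the coarser one: an integer z bounds Nx exactly when
    kz bounds Mx, and a ceiling is known from its integer upper bounds.\<close>
  moreover have "\<lceil>real N * s\<rceil> = \<lceil>real N * t\<rceil>" if "\<lceil>real M * s\<rceil> = \<lceil>real M * t\<rceil>" for s t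
  proof -
    have "\<lceil>real N * x\<rceil> \<le> z \<longleftrightarrow> \<lceil>real M * x\<rceil> \<le> int k * z" for x z
    proof -
      have "real N * x \<le> z \<longleftrightarrow> real k * (real N * x) \<le> real k * z"
        using assms(2) k by simp
      then show ?thesis
        by (simp add: ceiling_le_iff k mult.assoc)
    qed
    then show ?thesis
      using that by (metis order_antisym order_refl)
  qed
  ultimately show ?thesis
    unfolding grid_exchanges_def by blast
qed

lemma subgroup_grid_exchanges:
  assumes "N > 0"
  shows "subgroup (grid_exchanges N) (BijGroup {0..1})"
proof (rule group.subgroupI[OF group_BijGroup])
  show "grid_exchanges N \<subseteq> carrier (BijGroup {0..1})"
    by (auto simp: BijGroup_def grid_exchange_Bij)
  have "(\<lambda>x\<in>{0..1}. x) \<in> grid_exchanges N"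
    by (simp add: grid_exchanges_def id_Bij)
  then show "grid_exchanges N \<noteq> {}" by blast
next
  fix f
  assume f: "f \<in> grid_exchanges N"
  define h where "h = (\<lambda>x\<in>{0..1}. inv_into {0..1} f x)"
  have h: "h \<in> Bij {0..1}"
    unfolding h_def by (intro restrict_inv_into_Bij grid_exchange_Bij[OF f])
  have img: "f ` {0..1} = {0..1}"
    using grid_exchange_Bij[OF f] by (simp add: Bij_def bij_betw_def)
  have fh: "f (h y) = y" "h y \<in> {0..1}" if "y \<in> {0..1}" for y
    using that img by (simp_all add: h_def f_inv_into_f inv_into_into del: atLeastAtMost_iff)
  have f0: "f 0 = 0"
    by (rule grid_exchange_0[OF f])
  have h0: "h 0 = 0"
    using grid_exchange_inj[OF f, of "h 0" 0] fh[of 0] f0 by simp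
  have h_range: "h y \<in> {0<..1}" if "y \<in> {0<..1}" for y
    using fh[of y] that f0 by (cases "h y = 0") auto
  have "real N * (h y - y) \<in> \<int>" if "y \<in> {0<..1}" for y
  proof -
    have "real N * (f (h y) - h y) \<in> \<int>"
      by (rule grid_exchange_Ints[OF f h_range[OF that]])
    then have "- (real N * (y - h y)) \<in> \<int>"
      using fh[of y] that by simp
    then show ?thesis by (simp add: algebra_simps)
  qed
  moreover have "h y - y = h z - z"
    if y: "y \<in> {0<..1}" and z: "z \<in> {0<..1}" and eq: "\<lceil>real N * y\<rceil> = \<lceil>real N * z\<rceil>" for y z
  proof -
    \<comment> \<open>\<open>?p x\<close> is the right end point of the cell containing the preimage
      of x, and f sends it to the right end point of the cell of x. Points y, z of one cell thus
      give the same image, and injectivity of f puts their preimages into one cell.\<close>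
    let ?p = "\<lambda>x. \<lceil>real N * h x\<rceil> / real N"
    have p: "f (?p x) = \<lceil>real N * x\<rceil> / real N" "?p x \<in> {0..1}" if "x \<in> {0<..1}" for x
    proof -
      have "f (h x) = x" "h x \<in> {0<..1}"
        using fh[of x] h_range that by simp_all
      note hx = this
      show "?p x \<in> {0..1}"
        using ceiling_grid_point(1)[OF assms hx(2)] by auto
      have "f (?p x) = (x - h x) + ?p x"
        using grid_exchange_at_grid_point[OF assms f hx(2)] hx(1) by simp
      also have "\<dots> = (real N * (x - h x) + \<lceil>real N * h x\<rceil>) / real N"
        using assms by (simp add: add_divide_distrib)
      also have "\<dots> = \<lceil>real N * x\<rceil> / real N"
        using grid_exchange_ceiling[OF f hx(2)] by (simp only: hx(1))
      finally show "f (?p x) = \<lceil>real N * x\<rceil> / real N" .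
    qed
    have "?p y = ?p z"
      using grid_exchange_inj[OF f p(2)[OF y] p(2)[OF z]] p(1)[OF y] p(1)[OF z] eq by simp
    then have "\<lceil>real N * h y\<rceil> = \<lceil>real N * h z\<rceil>"
      using assms by simp
    then have "f (h y) - h y = f (h z) - h z"
      by (rule grid_exchange_cell[OF f h_range[OF y] h_range[OF z]])
    then show ?thesis
      using fh[of y] fh[of z] y z by simp
  qed
  ultimately have "h \<in> grid_exchanges N"
    using h h0 unfolding grid_exchanges_def by blast
  then show "inv\<^bsub>BijGroup {0..1}\<^esub> f \<in> grid_exchanges N"
    by (simp add: h_def inv_BijGroup grid_exchange_Bij[OF f])
next
  fix g f
  assume g: "g \<in> grid_exchanges N" and f: "f \<in> grid_exchanges N"
  define h where "h = compose {0..1} g f"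
  have h: "h t = g (f t)" if "t \<in> {0..1}" for t
    using that by (simp add: h_def compose_eq)
  have "real N * (h t - t) \<in> \<int>" if t: "t \<in> {0<..1}" for t
  proof -
    have "real N * (g (f t) - f t) + real N * (f t - t) \<in> \<int>"
      by (intro Ints_add grid_exchange_Ints[OF g grid_exchange_range[OF f t]] grid_exchange_Ints[OF f t])
    then show ?thesis using t by (simp add: h algebra_simps)
  qed
  moreover have "h s - s = h t - t"
    if s: "s \<in> {0<..1}" and t: "t \<in> {0<..1}" and eq: "\<lceil>real N * s\<rceil> = \<lceil>real N * t\<rceil>" for s t
  proof -
    have 1: "f s - s = f t - t"
      by (rule grid_exchange_cell[OF f s t eq])
    have "real_of_int \<lceil>real N * f s\<rceil> = real_of_int \<lceil>real N * f t\<rceil>"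
      by (simp only: grid_exchange_ceiling[OF f s] grid_exchange_ceiling[OF f t] 1 eq)
    then have "g (f s) - f s = g (f t) - f t"
      unfolding of_int_eq_iff
      by (rule grid_exchange_cell[OF g grid_exchange_range[OF f s] grid_exchange_range[OF f t]])
    with 1 show ?thesis using s t by (simp add: h)
  qed
  moreover have "h 0 = 0"
    using grid_exchange_0[OF f] grid_exchange_0[OF g] by (simp add: h)
  moreover have "h \<in> Bij {0..1}"
    unfolding h_def by (intro compose_Bij grid_exchange_Bij[OF g] grid_exchange_Bij[OF f])
  ultimately have "h \<in> grid_exchanges N"
    unfolding grid_exchanges_def by blast
  then show "g \<otimes>\<^bsub>BijGroup {0..1}\<^esub> f \<in> grid_exchanges N"
    using f g by (simp add: BijGroup_def grid_exchange_Bij h_def)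
qed

section \<open>Denominators available in \<Gamma>\<close>

locale rational_additive_group =
  fixes \<Gamma> :: "real set"
  assumes rational: "\<Gamma> \<subseteq> \<rat>"
    and zero_mem: "0 \<in> \<Gamma>"
    and add_mem: "x \<in> \<Gamma> \<Longrightarrow> y \<in> \<Gamma> \<Longrightarrow> x + y \<in> \<Gamma>"
    and uminus_mem: "x \<in> \<Gamma> \<Longrightarrow> - x \<in> \<Gamma>"
    and one_mem: "1 \<in> \<Gamma>"
begin

lemma of_int_mult_mem:
  assumes "x \<in> \<Gamma>"
  shows "of_int k * x \<in> \<Gamma>"
proof -
  have nat: "real n * x \<in> \<Gamma>" for n
    by (induction n) (use assms in \<open>auto simp: zero_mem add_mem distrib_right\<close>)
  show ?thesis
  proof (cases "k \<ge> 0")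
    case True
    then show ?thesis using nat[of "nat k"] by simp
  next
    case False
    then show ?thesis using uminus_mem[OF nat[of "nat (- k)"]] by simp
  qed
qed

text \<open>Bezout's identity for gcd(N, M), divided by NM. The product NM would not do as a common
  denominator, since 1/(NM) may lie outside \<Gamma>.\<close>

lemma inverse_lcm_mem:
  assumes "N > 0" and "M > 0" and "1 / real N \<in> \<Gamma>" and "1 / real M \<in> \<Gamma>"
  shows "1 / real (lcm N M) \<in> \<Gamma>"
proof -
  obtain u v where uv: "u * int N + v * int M = gcd (int N) (int M)"
    using bezout_int by blast
  have "real (gcd N M) = of_int u * real N + of_int v * real M"
    using arg_cong[OF uv, of real_of_int] by simp
  moreover have "real (gcd N M) * real (lcm N M) = real N * real M"
    by (simp flip: of_nat_mult)
  ultimately have "1 / real (lcm N M) = of_int u * (1 / real M) + of_int v * (1 / real N)"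
    using assms(1,2) by (simp add: field_simps lcm_pos_nat)
  then show ?thesis
    using assms by (simp add: add_mem of_int_mult_mem del: times_divide_eq_right)
qed

text \<open>For x = a/b in lowest terms, ua + vb = 1 becomes 1/b = ux + v, an integer combination of
  x and 1.\<close>

lemma denominator:
  assumes "x \<in> \<Gamma>"
  obtains N where "N > 0" and "1 / real N \<in> \<Gamma>" and "real N * x \<in> \<int>"
proof -
  obtain a b :: int where ab: "b > 0" "coprime a b" "x = of_int a / of_int b"
    using assms rational by (blast elim: Rats_cases')
  obtain u v where uv: "u * a + v * b = 1"
    using ab(2) bezout_int[of a b] by auto
  then have "real_of_int u * of_int a + of_int v * of_int b = 1"
    by (simp flip: of_int_mult of_int_add)
  then have "1 / real (nat b) = of_int u * x + of_int v * 1"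
    unfolding ab(3) using ab(1) by (simp add: field_simps)
  then have "1 / real (nat b) \<in> \<Gamma>"
    using of_int_mult_mem[OF assms] of_int_mult_mem[OF one_mem] add_mem by metis
  then show ?thesis
    using that[of "nat b"] ab by simp
qed

lemma common_denominator:
  assumes "finite S" and "S \<subseteq> \<Gamma>"
  shows "\<exists>N>0. 1 / real N \<in> \<Gamma> \<and> (\<forall>x\<in>S. real N * x \<in> \<int>)"
  using assms
proof (induction S)
  case empty
  show ?case using one_mem by (intro exI[of _ 1]) auto
next
  case (insert x S)
  then obtain N where N: "N > 0" "1 / real N \<in> \<Gamma>" "\<forall>x\<in>S. real N * x \<in> \<int>"
    by auto
  obtain M where M: "M > 0" "1 / real M \<in> \<Gamma>" "real M * x \<in> \<int>"
    using denominator insert.prems by blast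
  have mult: "real (lcm N M) * y \<in> \<int>" if K: "K dvd lcm N M" and y: "real K * y \<in> \<int>" for K y
  proof -
    obtain k where k: "lcm N M = K * k"
      using K by (rule dvdE)
    have "real k * (real K * y) \<in> \<int>"
      by (intro Ints_mult y) simp
    then show ?thesis
      unfolding k by (simp add: ac_simps)
  qed
  show ?case
    using N M mult[of N] mult[of M] by (intro exI[of _ "lcm N M"]) (auto simp: inverse_lcm_mem lcm_pos_nat)
qed

section \<open>IE(\<Gamma>) as a union of grid groups\<close>

lemma grid_exchange_imp_interval_exchange:
  assumes N: "N > 0" "1 / real N \<in> \<Gamma>" and f: "f \<in> grid_exchanges N"
  shows "interval_exchange \<Gamma> f"
proof -
  \<comment> \<open>Breakpoints are numbered from 1, hence the shift by one: piece i is ((i-1)/N,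
    i/N], and \<open>c i\<close> is the displacement of its right end point.\<close>
  define x where "x i = (real i - 1) / real N" for i :: nat
  define c where "c i = f (real i / real N) - real i / real N" for i :: nat
  have mem: "y \<in> \<Gamma>" if y: "real N * y \<in> \<int>" for y
  proof -
    obtain k where "real N * y = of_int k"
      using y by (rule Ints_cases)
    then have "y = of_int k * (1 / real N)"
      using N(1) by (simp add: field_simps)
    then show ?thesis
      using of_int_mult_mem[OF N(2)] by metis
  qed
  have grid: "real i / real N \<in> {0<..1}" if "i \<in> {1..<N + 1}" for i
    using that N(1) by auto
  have "x ` {1..N + 1} \<subseteq> \<Gamma>"
    using N(1) by (auto intro!: mem simp: x_def)
  moreover have "c ` {1..<N + 1} \<subseteq> \<Gamma>"
    by (intro image_subsetI mem) (simp add: c_def grid_exchange_Ints[OF f grid])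
  moreover have "f t = t + c i" if "i \<in> {1..<N + 1}" "t \<in> {x i<..x (i + 1)}" for i t
  proof -
    have "real i - 1 < real N * t" "real N * t \<le> real i"
      using that(2) N(1) by (auto simp: x_def field_simps)
    then have "\<lceil>real N * t\<rceil> = int i"
      by (simp add: ceiling_eq_iff)
    moreover have "t \<in> {0<..1}"
    proof -
      have "0 \<le> x i"
        using that(1) by (simp add: x_def)
      moreover have "x (i + 1) = real i / real N"
        by (simp add: x_def)
      ultimately show ?thesis
        using that(2) grid[OF that(1)] unfolding greaterThanAtMost_iff by linarith
    qed
    ultimately show ?thesis
      using grid_exchange_at_grid_point[OF N(1) f] by (simp add: c_def)
  qed
  moreover have "strict_mono_on {1..N + 1} x"
    using N(1) by (auto simp: strict_mono_on_def x_def divide_strict_right_mono)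
  moreover have "x 1 = 0" "x (N + 1) = 1" "2 \<le> N + 1"
    using N(1) by (auto simp: x_def)
  ultimately show ?thesis
    using grid_exchange_Bij[OF f] grid_exchange_0[OF f] unfolding interval_exchange_def
    by (intro conjI exI[of _ "N + 1"] exI[of _ x] exI[of _ c] ballI)
qed

lemma interval_exchange_imp_grid_exchange:
  assumes "interval_exchange \<Gamma> f"
  obtains N where "N > 0" and "1 / real N \<in> \<Gamma>" and "f \<in> grid_exchanges N"
proof -
  have f: "f \<in> Bij {0..1}" "f 0 = 0"
    using assms by (simp_all add: interval_exchange_def)
  obtain n :: nat and x c :: "nat \<Rightarrow> real"
    where n: "2 \<le> n" "x 1 = 0" "x n = 1"
      and mem: "x ` {1..n} \<subseteq> \<Gamma>" "c ` {1..<n} \<subseteq> \<Gamma>"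
      and exch: "\<forall>i\<in>{1..<n}. \<forall>t\<in>{x i<..x (i + 1)}. f t = t + c i"
    using assms unfolding interval_exchange_def by (elim conjE exE) (rule that)
  obtain N where N: "N > 0" "1 / real N \<in> \<Gamma>" "\<forall>y\<in>x ` {1..n} \<union> c ` {1..<n}. real N * y \<in> \<int>"
    using common_denominator[of "x ` {1..n} \<union> c ` {1..<n}"] mem by auto
  have cell: "\<exists>i\<in>{1..<n}. t \<in> {x i<..x (i + 1)}" if t: "t \<in> {0<..1}" for t
  proof -
    \<comment> \<open>The first breakpoint not below t closes the piece containing t; since
      \<open>x 1 = 0\<close> lies below t, a previous breakpoint exists.\<close>
    define m where "m = (LEAST m. 1 \<le> m \<and> t \<le> x m)"
    have "1 \<le> n \<and> t \<le> x n"
      using n t by auto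
    then have m: "1 \<le> m \<and> t \<le> x m" "m \<le> n"
      unfolding m_def by (rule LeastI, rule Least_le)
    have "m \<noteq> 1"
      using m n t by auto
    moreover have "\<not> (1 \<le> m - 1 \<and> t \<le> x (m - 1))"
      using m(1) by (intro not_less_Least[of _ "\<lambda>m. 1 \<le> m \<and> t \<le> x m", folded m_def]) simp
    ultimately show ?thesis
      using m by (intro bexI[of _ "m - 1"]) auto
  qed
  \<comment> \<open>Breakpoints are grid points, so the cell index of a point decides on which side
    of each breakpoint it lies; a cell therefore never straddles two pieces.\<close>
  have less_iff: "x j < t \<longleftrightarrow> x j < s"
    if j: "j \<in> {1..n}" and eq: "\<lceil>real N * s\<rceil> = \<lceil>real N * t\<rceil>" for j s t
  proof -
    have "real N * x j \<in> \<int>"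
      using N(3) j by blast
    then obtain k where k: "real N * x j = of_int k"
      by (rule Ints_cases)
    have "x j < r \<longleftrightarrow> k < \<lceil>real N * r\<rceil>" for r
      using N(1) by (simp add: less_ceiling_iff flip: k)
    then show ?thesis
      using eq by simp
  qed
  have "f \<in> grid_exchanges N"
    unfolding grid_exchanges_def
  proof (intro CollectI conjI f ballI impI)
    fix t :: real
    assume "t \<in> {0<..1}"
    then obtain i where i: "i \<in> {1..<n}" "t \<in> {x i<..x (i + 1)}"
      using cell by blast
    then show "real N * (f t - t) \<in> \<int>"
      using bspec[OF bspec[OF exch i(1)] i(2)] N(3) by auto
    fix s :: real
    assume "\<lceil>real N * t\<rceil> = \<lceil>real N * s\<rceil>"
    then have "s \<in> {x i<..x (i + 1)}"
      using i less_iff[of i t s] less_iff[of "i + 1" t s] by auto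
    then show "f t - t = f s - s"
      using bspec[OF bspec[OF exch i(1)]] i(2) by simp
  qed
  then show ?thesis
    using that N by blast
qed

text \<open>Serves twice: for pairs it gives closure under composition, for arbitrary finite sets
  local finiteness.\<close>

lemma finite_set_interval_exchanges:
  assumes "finite S" and "S \<subseteq> {f. interval_exchange \<Gamma> f}"
  shows "\<exists>N>0. 1 / real N \<in> \<Gamma> \<and> S \<subseteq> grid_exchanges N"
  using assms
proof (induction S)
  case empty
  show ?case using one_mem by (intro exI[of _ 1]) auto
next
  case (insert f S)
  then obtain N where N: "N > 0" "1 / real N \<in> \<Gamma>" "S \<subseteq> grid_exchanges N"
    by auto
  obtain M where M: "M > 0" "1 / real M \<in> \<Gamma>" "f \<in> grid_exchanges M"
    using interval_exchange_imp_grid_exchange insert.prems by blast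
  show ?case
    using N M grid_exchanges_mono[of N "lcm N M"] grid_exchanges_mono[of M "lcm N M"]
    by (intro exI[of _ "lcm N M"]) (auto simp: inverse_lcm_mem lcm_pos_nat)
qed

lemma locally_finite_IE: "locally_finite_group (IE \<Gamma>)"
proof -
  let ?E = "{f. interval_exchange \<Gamma> f}"
  have grid_subset: "grid_exchanges N \<subseteq> ?E" if "N > 0" "1 / real N \<in> \<Gamma>" for N
    using that grid_exchange_imp_interval_exchange by blast
  \<comment> \<open>Closure is inherited from the grid groups, which avoids computing breakpoints of
    composites and inverses.\<close>
  have E: "subgroup ?E (BijGroup {0..1})"
  proof (rule group.subgroupI[OF group_BijGroup])
    show "?E \<subseteq> carrier (BijGroup {0..1})"
      by (auto simp: BijGroup_def interval_exchange_def)
    show "?E \<noteq> {}"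
      using grid_subset[of 1] one_mem subgroup.one_closed[OF subgroup_grid_exchanges[of 1]] by auto
  next
    fix f
    assume "f \<in> ?E"
    then obtain N where "N > 0" "1 / real N \<in> \<Gamma>" "f \<in> grid_exchanges N"
      using interval_exchange_imp_grid_exchange by blast
    then show "inv\<^bsub>BijGroup {0..1}\<^esub> f \<in> ?E"
      using subgroup.m_inv_closed[OF subgroup_grid_exchanges] grid_subset by blast
  next
    fix g f
    assume "g \<in> ?E" "f \<in> ?E"
    then obtain N where N: "N > 0" "1 / real N \<in> \<Gamma>" "g \<in> grid_exchanges N" "f \<in> grid_exchanges N"
      using finite_set_interval_exchanges[of "{g, f}"] by auto
    show "g \<otimes>\<^bsub>BijGroup {0..1}\<^esub> f \<in> ?E"
      by (intro subsetD[OF grid_subset[OF N(1,2)]] subgroup.m_closed[OF subgroup_grid_exchanges] N)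
  qed
  have "\<exists>H. subgroup H (IE \<Gamma>) \<and> finite H \<and> S \<subseteq> H" if S: "finite S" "S \<subseteq> ?E" for S
  proof -
    obtain N where N: "N > 0" "1 / real N \<in> \<Gamma>" "S \<subseteq> grid_exchanges N"
      using finite_set_interval_exchanges[OF S] by blast
    then show ?thesis
      using group.subgroup_incl[OF group_BijGroup subgroup_grid_exchanges E grid_subset]
        finite_grid_exchanges by (auto simp: IE_def)
  qed
  moreover have "group (IE \<Gamma>)"
    unfolding IE_def by (rule group.subgroup_imp_group[OF group_BijGroup E])
  ultimately show ?thesis
    by (simp add: locally_finite_group_def) (simp add: IE_def)
qed

end

theorem mainTheorem14:
  fixes \<Gamma> :: "real set"
  assumes "\<Gamma> \<subseteq> \<rat>"
    and "0 \<in> \<Gamma>"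
    and "\<And>x y. x \<in> \<Gamma> \<Longrightarrow> y \<in> \<Gamma> \<Longrightarrow> x + y \<in> \<Gamma>"
    and "\<And>x. x \<in> \<Gamma> \<Longrightarrow> - x \<in> \<Gamma>"
    and "closure \<Gamma> = UNIV"
    and "1 \<in> \<Gamma>"
  shows "rationally_acyclic (IE \<Gamma>) \<and> rationally_acyclic (derived_group (IE \<Gamma>))"
proof -
  interpret rational_additive_group \<Gamma>
    using assms by unfold_locales
  have IE: "group (IE \<Gamma>)"
    using locally_finite_IE by (simp add: locally_finite_group_def)
  have "locally_finite_group (derived_group (IE \<Gamma>))"
    unfolding derived_group_def
    by (intro locally_finite_group_subgroup locally_finite_IE group.derived_is_subgroup[OF IE] order_refl)
  then show ?thesis
    by (intro conjI locally_finite_group_rationally_acyclic locally_finite_IE)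
qed

end
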